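(* Let $k$ and $r$ be positive integers. There is no infinite sequence $(a_1,b_1),(a_2,b_2),\ldots$ of lattice points in the first quadrant ($a_i,b_i\ge0$) such that: (i) each $a_i+b_i\sqrt{2}$ is a prime of $\mathbb{Z}[\sqrt{2}]$; (ii) the Euclidean distance between $(a_i,b_i)$ and $(a_{i+1},b_{i+1})$ is at most $k$ for every $i$; (iii) the Euclidean distance from each $(a_i,b_i)$ to the line $y=x/\sqrt{2}$ is at most $r$; and (iv) the sequence is unbounded, i.e., $\sup_i \sqrt{a_i^2+b_i^2}=\infty$.
   Context: $\mathbb{Z}[\sqrt{2}]=\{a+b\sqrt{2} : a,b\in\mathbb{Z}\}$, with $a+b\sqrt{2}$ identified with the lattice point $(a,b)\in\mathbb{Z}^2$, is a unique factorization domain with norm $N(a+b\sqrt{2})=a^2-2b^2$; a prime is a nonzero non-unit element divisible only by units (elements of norm $\pm1$) and its associates. *)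

theory Defs
  imports "HOL-Analysis.Analysis" "HOL-Computational_Algebra.Factorial_Ring"
begin

text \<open>\<open>ZSqrt2 a b\<close> is the element \<open>a + b\<surd>2\<close>, identified with the lattice point \<open>(a, b)\<close>.\<close>

datatype zsqrt2 = ZSqrt2 (rat_part: int) (irr_part: int)

lemma zsqrt2_eq_iff: "x = y \<longleftrightarrow> rat_part x = rat_part y \<and> irr_part x = irr_part y"
  by (cases x; cases y) simp

instantiation zsqrt2 :: comm_ring_1
begin

definition "0 = ZSqrt2 0 0"
definition "1 = ZSqrt2 1 0"
definition "x + y = ZSqrt2 (rat_part x + rat_part y) (irr_part x + irr_part y)"
definition "x - y = ZSqrt2 (rat_part x - rat_part y) (irr_part x - irr_part y)"
definition "- x = ZSqrt2 (- rat_part x) (- irr_part x)"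
definition "x * y = ZSqrt2
  (rat_part x * rat_part y + 2 * irr_part x * irr_part y)
  (rat_part x * irr_part y + irr_part x * rat_part y)"

instance
  by standard
    (simp_all add: zsqrt2_eq_iff zero_zsqrt2_def one_zsqrt2_def plus_zsqrt2_def
      minus_zsqrt2_def uminus_zsqrt2_def times_zsqrt2_def algebra_simps)

end

lemmas zsqrt2_defs = zero_zsqrt2_def one_zsqrt2_def plus_zsqrt2_def
  minus_zsqrt2_def uminus_zsqrt2_def times_zsqrt2_def

definition real_of_zsqrt2 :: "zsqrt2 \<Rightarrow> real" where
  "real_of_zsqrt2 x = of_int (rat_part x) + of_int (irr_part x) * sqrt 2"

definition zsqrt2_norm :: "zsqrt2 \<Rightarrow> int" where
  "zsqrt2_norm x = rat_part x ^ 2 - 2 * irr_part x ^ 2"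

definition zsqrt2_unit :: "zsqrt2 \<Rightarrow> bool" where
  "zsqrt2_unit x \<longleftrightarrow> zsqrt2_norm x = 1 \<or> zsqrt2_norm x = - 1"

definition zsqrt2_associated :: "zsqrt2 \<Rightarrow> zsqrt2 \<Rightarrow> bool" where
  "zsqrt2_associated x y \<longleftrightarrow> (\<exists>u. zsqrt2_unit u \<and> x = u * y)"

definition zsqrt2_prime :: "zsqrt2 \<Rightarrow> bool" where
  "zsqrt2_prime p \<longleftrightarrow> p \<noteq> 0 \<and> \<not> zsqrt2_unit p \<and>
     (\<forall>d. d dvd p \<longrightarrow> zsqrt2_unit d \<or> zsqrt2_associated d p)"

lemma square_eq_double_square_imp_zero:
  fixes a b :: int
  assumes "a\<^sup>2 = 2 * b\<^sup>2"
  shows "a = 0 \<and> b = 0"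
  using assms
proof (induction "nat \<bar>a\<bar>" arbitrary: a b rule: less_induct)
  case less
  have "even (a\<^sup>2)" using less.prems by simp
  then obtain c where c: "a = 2 * c" by auto
  have b: "b\<^sup>2 = 2 * c\<^sup>2" using less.prems by (simp add: c power_mult_distrib)
  show ?case
  proof (cases "a = 0")
    case True
    then show ?thesis using less.prems by simp
  next
    case False
    then have "b\<^sup>2 < a\<^sup>2" using less.prems by (cases "b = 0") auto
    then have "\<bar>b\<bar> < \<bar>a\<bar>" by (metis abs_le_square_iff linorder_not_less)
    then have "b = 0 \<and> c = 0" using less.hyps[of b c] b by simp
    then show ?thesis using c by simp
  qed
qed

lemma zsqrt2_norm_eq_0_iff [simp]: "zsqrt2_norm x = 0 \<longleftrightarrow> x = 0"
  using square_eq_double_square_imp_zero[of "rat_part x" "irr_part x"]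
  by (auto simp: zsqrt2_norm_def zsqrt2_eq_iff zero_zsqrt2_def)

lemma zsqrt2_norm_mult: "zsqrt2_norm (x * y) = zsqrt2_norm x * zsqrt2_norm y"
  by (simp add: zsqrt2_norm_def times_zsqrt2_def power2_eq_square algebra_simps)

instance zsqrt2 :: idom
proof
  fix x y :: zsqrt2
  assume "x \<noteq> 0" "y \<noteq> 0"
  then show "x * y \<noteq> 0"
    by (metis mult_eq_0_iff zsqrt2_norm_eq_0_iff zsqrt2_norm_mult)
qed

lemma real_of_zsqrt2_add: "real_of_zsqrt2 (x + y) = real_of_zsqrt2 x + real_of_zsqrt2 y"
  by (simp add: real_of_zsqrt2_def plus_zsqrt2_def algebra_simps)

lemma real_of_zsqrt2_mult: "real_of_zsqrt2 (x * y) = real_of_zsqrt2 x * real_of_zsqrt2 y"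
  by (simp add: real_of_zsqrt2_def times_zsqrt2_def algebra_simps)

lemma real_of_zsqrt2_eq_0_iff: "real_of_zsqrt2 x = 0 \<longleftrightarrow> x = 0"
proof
  assume "real_of_zsqrt2 x = 0"
  then have "(of_int (rat_part x) :: real)\<^sup>2 = (of_int (irr_part x) * sqrt 2)\<^sup>2"
    by (simp add: real_of_zsqrt2_def eq_neg_iff_add_eq_0[symmetric])
  then have "(of_int ((rat_part x)\<^sup>2) :: real) = of_int (2 * (irr_part x)\<^sup>2)"
    by (simp add: power_mult_distrib)
  then have "(rat_part x)\<^sup>2 = 2 * (irr_part x)\<^sup>2"
    by (simp only: of_int_eq_iff)
  then show "x = 0"
    by (simp add: zsqrt2_norm_def flip: zsqrt2_norm_eq_0_iff)
qed (simp add: real_of_zsqrt2_def zero_zsqrt2_def)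

lemma inj_real_of_zsqrt2: "inj real_of_zsqrt2"
proof (rule injI)
  fix x y
  assume "real_of_zsqrt2 x = real_of_zsqrt2 y"
  then have "real_of_zsqrt2 (x - y) = 0"
    using real_of_zsqrt2_add[of "x - y" y] by simp
  then show "x = y" by (simp add: real_of_zsqrt2_eq_0_iff)
qed

lemma zsqrt2_unit_iff: "zsqrt2_unit x \<longleftrightarrow> x dvd 1"
proof
  assume "zsqrt2_unit x"
  then have n: "zsqrt2_norm x * zsqrt2_norm x = 1" by (auto simp: zsqrt2_unit_def)
  let ?n = "zsqrt2_norm x"
  have "x * ZSqrt2 (?n * rat_part x) (- ?n * irr_part x) = ZSqrt2 (?n * ?n) 0"
    by (simp add: times_zsqrt2_def zsqrt2_norm_def power2_eq_square algebra_simps)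
  then show "x dvd 1" using n by (metis dvd_triv_left one_zsqrt2_def)
next
  assume "x dvd 1"
  then obtain y where "1 = x * y" by (auto elim: dvdE)
  then have "zsqrt2_norm x * zsqrt2_norm y = zsqrt2_norm 1"
    by (metis zsqrt2_norm_mult)
  then have "zsqrt2_norm x * zsqrt2_norm y = 1"
    by (simp add: zsqrt2_norm_def one_zsqrt2_def)
  then show "zsqrt2_unit x" using zmult_eq_1_iff by (auto simp: zsqrt2_unit_def)
qed

lemma zsqrt2_prime_iff_irreducible: "zsqrt2_prime p \<longleftrightarrow> irreducible p"
proof
  assume p: "zsqrt2_prime p"
  show "irreducible p"
  proof (rule irreducibleI)
    fix a b
    assume ab: "p = a * b"
    then have "zsqrt2_unit a \<or> zsqrt2_associated a p"
      using p by (auto simp: zsqrt2_prime_def)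
    then show "a dvd 1 \<or> b dvd 1"
    proof
      assume "zsqrt2_associated a p"
      then obtain u where "a = u * p" by (auto simp: zsqrt2_associated_def)
      then have "a * 1 = a * (u * b)" using ab by (simp add: algebra_simps)
      moreover have "a \<noteq> 0" using p ab by (auto simp: zsqrt2_prime_def)
      ultimately have "1 = u * b" by (metis mult_cancel_left)
      then show ?thesis by (metis dvd_triv_right)
    qed (simp add: zsqrt2_unit_iff)
  qed (use p in \<open>auto simp: zsqrt2_prime_def zsqrt2_unit_iff\<close>)
next
  assume p: "irreducible p"
  have "zsqrt2_unit d \<or> zsqrt2_associated d p" if "d dvd p" for d
  proof -
    from that obtain c where c: "p = d * c" by (auto elim: dvdE)
    have "d dvd 1 \<or> c dvd 1" using irreducibleD[OF p c] .
    then show ?thesis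
    proof
      assume "c dvd 1"
      then obtain u where u: "1 = c * u" by (auto elim: dvdE)
      then have "u dvd 1" by (metis dvd_triv_right)
      moreover have "d = u * p" using c u by (metis mult.assoc mult.commute mult_1)
      ultimately show ?thesis by (auto simp: zsqrt2_associated_def zsqrt2_unit_iff)
    qed (simp add: zsqrt2_unit_iff)
  qed
  then show "zsqrt2_prime p"
    using p by (auto simp: zsqrt2_prime_def zsqrt2_unit_iff irreducible_def)
qed

end

theory Submission
  imports Defs "HOL-Number_Theory.Cong"
begin

text \<open>
  By the Chinese remainder theorem there are integers \<open>A\<close>, \<open>B\<close> such that every point of the box
  \<open>[A, A + m] \<times> [B, B + n]\<close> has both coordinates divisible by the square of a rational prime
  depending on the point; no such point is a prime of \<open>\<int>[\<surd>2]\<close>. This property persists when \<open>A\<close> and \<open>B\<close>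
  are translated by multiples of a common modulus \<open>M\<close>, and since the numbers \<open>y\<surd>2 - x\<close> with
  integers \<open>y > 0\<close> and \<open>x\<close> are dense in \<open>\<real>\<close>, some translate lies arbitrarily far out and within
  bounded distance of the line \<open>y = x/\<surd>2\<close>. A sufficiently large box blocks the whole strip, and an
  unbounded sequence with steps at most \<open>k\<close> cannot jump over it.
\<close>

text \<open>The element splits as \<open>q\<close> times another multiple of \<open>q\<close>, and
  both factors have norm divisible by \<open>q\<close>, so neither is a unit. One factor
  \<open>q\<close> would not suffice: the cofactor could be a unit.\<close>

lemma not_zsqrt2_prime_if_square_dvd:
  fixes a b q :: int
  assumes "q > 1" "q\<^sup>2 dvd a" "q\<^sup>2 dvd b"
  shows "\<not> zsqrt2_prime (ZSqrt2 a b)"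
proof
  assume "zsqrt2_prime (ZSqrt2 a b)"
  then have irr: "irreducible (ZSqrt2 a b)" by (simp add: zsqrt2_prime_iff_irreducible)
  obtain c d where "a = q\<^sup>2 * c" "b = q\<^sup>2 * d" using assms by (auto elim!: dvdE)
  then have "ZSqrt2 a b = ZSqrt2 q 0 * ZSqrt2 (q * c) (q * d)"
    by (simp add: times_zsqrt2_def power2_eq_square)
  from irreducibleD[OF irr this]
  have "\<bar>zsqrt2_norm (ZSqrt2 q 0)\<bar> = 1 \<or> \<bar>zsqrt2_norm (ZSqrt2 (q * c) (q * d))\<bar> = 1"
    by (auto simp: zsqrt2_unit_def simp flip: zsqrt2_unit_iff)
  moreover have "q dvd zsqrt2_norm (ZSqrt2 q 0)" "q dvd zsqrt2_norm (ZSqrt2 (q * c) (q * d))"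
    by (auto simp: zsqrt2_norm_def power2_eq_square intro!: dvd_diff)
  ultimately have "q dvd 1" by (metis dvd_abs_iff)
  with \<open>q > 1\<close> show False by simp
qed

lemma sqrt_2_irrational: "sqrt 2 \<notin> \<rat>"
proof
  assume "sqrt 2 \<in> \<rat>"
  then obtain p q where q: "q > 0" and pq: "sqrt 2 = of_int p / of_int q"
    by (meson Rats_cases')
  then have "real_of_zsqrt2 (ZSqrt2 p (- q)) = 0"
    by (simp add: real_of_zsqrt2_def)
  then show False using q by (simp add: real_of_zsqrt2_eq_0_iff zero_zsqrt2_def)
qed

lemma prime_free_box:
  fixes m n :: nat
  obtains M A B :: int where "M > 0"
    and "\<And>x y i j. i \<in> {0..int m} \<Longrightarrow> j \<in> {0..int n} \<Longrightarrow>
           \<not> zsqrt2_prime (ZSqrt2 (A + M * x + i) (B + M * y + j))"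
proof -
  \<comment> \<open>Pairing followed by enumeration of the primes gives each box point its own
    prime, so the moduli are pairwise coprime.\<close>
  define p where "p ij = enumerate {p :: nat. prime p} (prod_encode ij)" for ij
  have p: "prime (p ij)" for ij
    using enumerate_in_set[OF primes_infinite] by (auto simp: p_def)
  have "inj p"
    unfolding p_def
    using inj_compose[OF inj_enumerate[OF primes_infinite] inj_prod_encode] by (simp add: comp_def)
  then have cop: "coprime ((p ij)\<^sup>2) ((p ij')\<^sup>2)" if "ij \<noteq> ij'" for ij ij'
    using that primes_coprime[OF p p, of ij ij'] by (simp add: inj_eq)
  define I where "I = {..m} \<times> {..n}"
  have fin: "finite I" by (simp add: I_def)
  have ex: "\<exists>A. \<forall>ij\<in>I. (p ij)\<^sup>2 dvd A + f ij" for f :: "nat \<times> nat \<Rightarrow> nat"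
  proof -
    \<comment> \<open>The wanted residue is \<open>- f ij\<close>. Adding
      \<open>(p ij)\<^sup>2 * f ij\<close> makes it a natural number, so the truncated subtraction
      is exact.\<close>
    have "\<exists>A. \<forall>ij\<in>I. [A = (p ij)\<^sup>2 * f ij - f ij] (mod (p ij)\<^sup>2)"
      by (rule chinese_remainder_nat[OF fin]) (intro ballI impI cop)
    then obtain A where A: "\<And>ij. ij \<in> I \<Longrightarrow> [A = (p ij)\<^sup>2 * f ij - f ij] (mod (p ij)\<^sup>2)"
      by blast
    have "(p ij)\<^sup>2 dvd A + f ij" if "ij \<in> I" for ij
    proof -
      have "f ij \<le> (p ij)\<^sup>2 * f ij" using prime_gt_0_nat[OF p, of ij] by simp
      then have "[A + f ij = (p ij)\<^sup>2 * f ij] (mod (p ij)\<^sup>2)"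
        using cong_add[OF A[OF that] cong_refl, of "f ij"] by simp
      then show ?thesis by (simp add: cong_dvd_iff)
    qed
    then show ?thesis by blast
  qed
  obtain A where A: "\<And>ij. ij \<in> I \<Longrightarrow> (p ij)\<^sup>2 dvd A + fst ij"
    using ex[of fst] by blast
  obtain B where B: "\<And>ij. ij \<in> I \<Longrightarrow> (p ij)\<^sup>2 dvd B + snd ij"
    using ex[of snd] by blast
  define M where "M = (\<Prod>ij\<in>I. (p ij)\<^sup>2)"
  show thesis
  proof (rule that[of "int M" "int A" "int B"])
    show "int M > 0" using p by (auto simp: M_def intro!: prod_pos prime_gt_0_nat)
  next
    fix x y i j :: int
    assume ij: "i \<in> {0..int m}" "j \<in> {0..int n}"
    define s where "s = (nat i, nat j)"
    have s: "s \<in> I" using ij by (auto simp: s_def I_def)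
    have M: "int ((p s)\<^sup>2) dvd int M"
      using fin s by (simp only: M_def int_dvd_int_iff) (rule dvd_prodI)
    have "int ((p s)\<^sup>2) dvd int (A + nat i)" "int ((p s)\<^sup>2) dvd int (B + nat j)"
      using A[OF s] B[OF s] by (simp_all only: s_def fst_conv snd_conv int_dvd_int_iff)
    then have "int ((p s)\<^sup>2) dvd int (A + nat i) + int M * x"
              "int ((p s)\<^sup>2) dvd int (B + nat j) + int M * y"
      using M by (simp_all only: dvd_add dvd_mult2)
    then show "\<not> zsqrt2_prime (ZSqrt2 (int A + int M * x + i) (int B + int M * y + j))"
      using ij prime_gt_1_nat[OF p, of s]
      by (intro not_zsqrt2_prime_if_square_dvd[of "int (p s)"]) (simp_all add: algebra_simps)
  qed
qed

lemma prime_free_box_near_line: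
  fixes m n :: nat and c :: real and N :: int
  obtains B A :: int where "B > N" "\<bar>of_int A - sqrt 2 * of_int B - c\<bar> < 1"
    and "\<And>i j. i \<in> {0..int m} \<Longrightarrow> j \<in> {0..int n} \<Longrightarrow> \<not> zsqrt2_prime (ZSqrt2 (A + i) (B + j))"
proof -
  obtain M A B :: int where M: "M > 0"
    and np: "\<And>x y i j. i \<in> {0..int m} \<Longrightarrow> j \<in> {0..int n} \<Longrightarrow>
           \<not> zsqrt2_prime (ZSqrt2 (A + M * x + i) (B + M * y + j))"
    by (rule prime_free_box[where m = m and n = n]) (rule that)
  \<comment> \<open>As \<open>M \<ge> 1\<close>, any shift by \<open>M * (t + y)\<close> with
    \<open>y > 0\<close> exceeds \<open>\<bar>N\<bar> + \<bar>B\<bar>\<close> and so carries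
    \<open>B\<close> beyond \<open>N\<close>.\<close>
  define t where "t = \<bar>N\<bar> + \<bar>B\<bar>"
  \<comment> \<open>Solves for the value of \<open>y * sqrt 2 - x\<close> that would make the
    translated corner meet the target \<open>c\<close> exactly. Scaling by \<open>M\<close> turns
    the tolerance \<open>1 / M\<close> into \<open>1\<close>.\<close>
  define \<alpha> where "\<alpha> = (of_int A - sqrt 2 * of_int (B + M * t) - c) / of_int M"
  obtain x y where y: "y > 0" and xy: "\<bar>of_int y * sqrt 2 - of_int x - \<alpha>\<bar> < 1 / of_int M"
    using sequence_of_fractional_parts_is_dense[OF sqrt_2_irrational, of "1 / of_int M" \<alpha>] M
    by (metis of_int_0_less_iff zero_less_divide_1_iff)
  show thesis
  proof (rule that)
    have "t + y \<le> M * (t + y)" using M y mult_right_mono[of 1 M "t + y"] by (simp add: t_def)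
    then show "B + M * (t + y) > N" using y by (simp add: t_def)
    have "\<bar>of_int (A + M * x) - sqrt 2 * of_int (B + M * (t + y)) - c\<bar>
        = of_int M * \<bar>of_int y * sqrt 2 - of_int x - \<alpha>\<bar>"
    proof -
      have "of_int (A + M * x) - sqrt 2 * of_int (B + M * (t + y)) - c
          = - (of_int M * (of_int y * sqrt 2 - of_int x - \<alpha>))"
        using M by (simp add: \<alpha>_def field_simps)
      then show ?thesis using M by (simp add: abs_mult)
    qed
    also have "\<dots> < 1" using xy M by (simp add: field_simps)
    finally show "\<bar>of_int (A + M * x) - sqrt 2 * of_int (B + M * (t + y)) - c\<bar> < 1" .
  qed (rule np)
qed

text \<open>The form \<open>a - sqrt 2 * b\<close> vanishes on the line and changes by at most
  \<open>1 + sqrt 2 < 3\<close> times the distance moved.\<close>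

lemma abs_diff_le_infdist_line:
  fixes a b :: real
  shows "\<bar>a - sqrt 2 * b\<bar> \<le> 3 * infdist (a, b) {(x, y). y = x / sqrt 2}"
proof -
  let ?L = "{(x :: real, y :: real). y = x / sqrt 2}"
  have "(0, 0) \<in> ?L" by simp
  then have ne: "?L \<noteq> {}" by blast
  have "\<bar>a - sqrt 2 * b\<bar> / 3 \<le> dist (a, b) z" if "z \<in> ?L" for z
  proof -
    obtain x y where z: "z = (x, y)" and y: "sqrt 2 * y = x"
      using \<open>z \<in> ?L\<close> by auto
    have "a - sqrt 2 * b = (a - x) - sqrt 2 * (b - y)" using y by (simp add: algebra_simps)
    then have "\<bar>a - sqrt 2 * b\<bar> \<le> \<bar>a - x\<bar> + sqrt 2 * \<bar>b - y\<bar>"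
      using abs_triangle_ineq4[of "a - x" "sqrt 2 * (b - y)"] by (simp add: abs_mult)
    also have "\<dots> \<le> dist (a, b) z + 2 * dist (a, b) z"
      using dist_fst_le[of "(a, b)" z] dist_snd_le[of "(a, b)" z] sqrt2_less_2
      by (intro add_mono mult_mono) (auto simp: z dist_real_def)
    finally show ?thesis by simp
  qed
  then have "\<bar>a - sqrt 2 * b\<bar> / 3 \<le> infdist (a, b) ?L"
    unfolding infdist_notempty[OF ne] by (intro cINF_greatest ne)
  then show ?thesis by simp
qed

text \<open>At the first index with \<open>B \<le> b i\<close>, the preceding term is still below
  \<open>B\<close>, so one step overshoots by at most \<open>k\<close>.\<close>

lemma bounded_step_seq_hits_interval:
  fixes b :: "nat \<Rightarrow> int"
  assumes "b 0 < B" "B \<le> b n" "\<And>i. b (Suc i) \<le> b i + k"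
  obtains i where "B \<le> b i" "b i \<le> B + k"
proof -
  define i where "i = (LEAST i. B \<le> b i)"
  have i: "B \<le> b i" unfolding i_def by (rule LeastI[of _ n]) (use assms in simp)
  then obtain j where j: "i = Suc j" using assms(1) by (cases i) auto
  then have "b j < B" using not_less_Least[of j "\<lambda>i. B \<le> b i"] by (simp add: i_def)
  then have "b i \<le> B + k" using assms(3)[of j] j by simp
  with i show thesis by (rule that)
qed

theorem theorem3p3:
  fixes k r :: nat
  assumes "k > 0" and "r > 0"
  shows "\<not> (\<exists>a b :: nat \<Rightarrow> int.
     (\<forall>i. a i \<ge> 0 \<and> b i \<ge> 0) \<and>
     (\<forall>i. zsqrt2_prime (ZSqrt2 (a i) (b i))) \<and>
     (\<forall>i. dist (real_of_int (a i), real_of_int (b i))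
               (real_of_int (a (Suc i)), real_of_int (b (Suc i))) \<le> real k) \<and>
     (\<forall>i. infdist (real_of_int (a i), real_of_int (b i))
               {(x :: real, y :: real). y = x / sqrt 2} \<le> real r) \<and>
     (SUP i. ereal (sqrt ((real_of_int (a i))\<^sup>2 + (real_of_int (b i))\<^sup>2))) = \<infinity>)"
proof (rule notI, elim exE conjE)
  fix a b :: "nat \<Rightarrow> int"
  assume nonneg: "\<forall>i. a i \<ge> 0 \<and> b i \<ge> 0"
    and prime: "\<forall>i. zsqrt2_prime (ZSqrt2 (a i) (b i))"
    and step: "\<forall>i. dist (real_of_int (a i), real_of_int (b i))
               (real_of_int (a (Suc i)), real_of_int (b (Suc i))) \<le> real k"
    and strip: "\<forall>i. infdist (real_of_int (a i), real_of_int (b i))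
               {(x :: real, y :: real). y = x / sqrt 2} \<le> real r"
    and unbdd: "(SUP i. ereal (sqrt ((real_of_int (a i))\<^sup>2 + (real_of_int (b i))\<^sup>2))) = \<infinity>"
  have near: "\<bar>of_int (a i) - sqrt 2 * of_int (b i)\<bar> \<le> 3 * real r" for i
    using abs_diff_le_infdist_line[of "of_int (a i)" "of_int (b i)"] strip[rule_format, of i]
    by linarith
  \<comment> \<open>For \<open>b i\<close> between \<open>B\<close> and \<open>B + k\<close>, the
    difference \<open>a i - A\<close> deviates from \<open>h\<close> by at most \<open>3 * r\<close>
    (strip), \<open>2 * k\<close> (slope \<open>sqrt 2 < 2\<close> over height \<open>k\<close>) and
    \<open>1\<close> (position of the box). The target \<open>- h\<close> thus centres a box of
    width \<open>2 * h\<close> that spans the strip.\<close>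
  define h where "h = 3 * r + 2 * k + 1"
  obtain B A where B: "B > b 0"
    and AB: "\<bar>of_int A - sqrt 2 * of_int B - (- real h)\<bar> < 1"
    and np: "\<And>i j. i \<in> {0..int (2 * h)} \<Longrightarrow> j \<in> {0..int k} \<Longrightarrow>
       \<not> zsqrt2_prime (ZSqrt2 (A + i) (B + j))"
    by (rule prime_free_box_near_line[where N = "b 0" and c = "- real h" and m = "2 * h" and n = k])
      (rule that)
  have b_step: "b (Suc i) \<le> b i + int k" for i
  proof -
    have "\<bar>real_of_int (b i) - real_of_int (b (Suc i))\<bar> \<le> real k"
      using dist_snd_le[of "(real_of_int (a i), real_of_int (b i))"
          "(real_of_int (a (Suc i)), real_of_int (b (Suc i)))"] step[rule_format, of i]
      by (simp add: dist_real_def)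
    then show ?thesis by linarith
  qed
  obtain n where n: "B \<le> b n"
  \<comment> \<open>If every \<open>b i\<close> stayed below \<open>B\<close>, the strip would bound
    \<open>a i\<close> as well, contradicting the infinite supremum.\<close>
  proof (rule ccontr)
    assume "\<not> thesis"
    with that have less: "b i < B" for i by (meson not_le)
    have "sqrt ((real_of_int (a i))\<^sup>2 + (real_of_int (b i))\<^sup>2) \<le> 3 * real r + 3 * of_int B" for i
    proof -
      have "sqrt ((real_of_int (a i))\<^sup>2 + (real_of_int (b i))\<^sup>2) \<le> of_int (a i) + of_int (b i)"
        using nonneg by (intro sqrt_sum_squares_le_sum) auto
      moreover have "sqrt 2 * of_int (b i) \<le> 2 * of_int (b i)"
        using nonneg sqrt2_less_2 by (intro mult_right_mono) auto
      moreover have "real_of_int (b i) \<le> of_int B" using less[of i] by simp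
      ultimately show ?thesis using near[of i] by linarith
    qed
    then have "(SUP i. ereal (sqrt ((real_of_int (a i))\<^sup>2 + (real_of_int (b i))\<^sup>2)))
        \<le> ereal (3 * real r + 3 * of_int B)"
      by (intro SUP_least) simp
    with unbdd show False by simp
  qed
  obtain i where i: "B \<le> b i" "b i \<le> B + int k"
    by (rule bounded_step_seq_hits_interval[OF B n b_step])
  have "real_of_int (b i - B) \<le> of_int (int k)" using i unfolding of_int_le_iff by linarith
  then have "sqrt 2 * real_of_int (b i - B) \<le> 2 * real k"
    using i sqrt2_less_2 by (intro mult_mono) auto
  moreover have "0 \<le> sqrt 2 * real_of_int (b i - B)" using i by simp
  ultimately have "real_of_int A \<le> real_of_int (a i)"
    "real_of_int (a i) \<le> real_of_int A + 2 * real h"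
    using near[of i] AB unfolding h_def of_int_diff right_diff_distrib by (simp_all, linarith+)
  then have "a i - A \<in> {0..int (2 * h)}" by simp
  from np[OF this, of "b i - B"] i prime show False by simp
qed

end
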